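(* Let $(M,\varphi_\alpha,\eta^\alpha,\xi_\alpha,g)$, $\alpha=1,2,3$, be a $3$-Sasakian manifold with Levi-Civita connection $\nabla$, and let $\bar\nabla$ be the linear connection on $M$ defined by $$\bar{\nabla}_XY=\nabla_XY-\sum_{\alpha=1}^3\eta^{\alpha}(X)\nabla_Y\xi_{\alpha}-\sum_{\alpha=1}^3\eta^{\alpha}(Y)\nabla_X\xi_{\alpha}+\sum_{\alpha=1}^3\Omega^{\alpha}(X,Y)\xi_{\alpha}.$$ Then $$(\bar\nabla_X\varphi_\alpha)Y=0\qquad\text{for all }\alpha=1,2,3$$ and all sections $X,Y$ of the distribution $\mathbf H=\bigcap_{\alpha=1}^3\ker\eta^\alpha$.
   Context: A Sasakian structure on a Riemannian manifold $(M,g)$ consists of a $(1,1)$-tensor $\varphi$, a vector field $\xi$ and a $1$-form $\eta$ with $\varphi^2=-I+\eta\otimes\xi$, $\eta(\xi)=1$, $\eta(X)=g(\xi,X)$, $g(\varphi X,\varphi Y)=g(X,Y)-\eta(X)\eta(Y)$ and $(\nabla_X\varphi)Y=g(X,Y)\xi-\eta(Y)X$, where $\nabla$ is the Levi-Civita connection of $g$. A $3$-Sasakian manifold is a Riemannian manifold $(M^{4n+3},g)$ with three Sasakian structures $(\varphi_\alpha,\eta^\alpha,\xi_\alpha,g)$, $\alpha=1,2,3$, such that for all even permutations $(\beta,\gamma,\theta)$ of $(1,2,3)$: $\varphi_\theta=\varphi_\beta\varphi_\gamma-\eta^\gamma\otimes\xi_\beta=-\varphi_\gamma\varphi_\beta+\eta^\beta\otimes\xi_\gamma$,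 $\xi_\theta=\varphi_\beta\xi_\gamma=-\varphi_\gamma\xi_\beta$, $\eta^\theta=\eta^\beta\circ\varphi_\gamma=-\eta^\gamma\circ\varphi_\beta$. Notation: $\Omega^\alpha(X,Y)=g(X,\varphi_\alpha Y)$, and $(\bar\nabla_X\varphi_\alpha)Y=\bar\nabla_X(\varphi_\alpha Y)-\varphi_\alpha(\bar\nabla_XY)$. *)

theory Defs
  imports "HOL-Analysis.Analysis" "HOL-Library.Function_Algebras"
begin

instantiation "fun" :: (type, scaleR) scaleR
begin
definition scaleR_fun_def: "c *\<^sub>R f = (\<lambda>x. c *\<^sub>R f x)"
instance ..
end

instance "fun" :: (type, real_vector) real_vector
  by standard (auto simp: fun_eq_iff scaleR_fun_def plus_fun_def scaleR_add_left scaleR_add_right)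


section \<open>Smooth manifolds\<close>

text \<open>Both notions are only used on open sets \<open>S\<close>.\<close>

primrec Ck_on :: "nat \<Rightarrow> 'e::euclidean_space set \<Rightarrow> ('e \<Rightarrow> 'f::real_normed_vector) \<Rightarrow> bool" where
  "Ck_on 0 S f \<longleftrightarrow> continuous_on S f"
| "Ck_on (Suc k) S f \<longleftrightarrow> (\<forall>x\<in>S. f differentiable (at x)) \<and>
     (\<forall>v. Ck_on k S (\<lambda>x. frechet_derivative f (at x) v))"

definition smooth_on :: "'e::euclidean_space set \<Rightarrow> ('e \<Rightarrow> 'f::real_normed_vector) \<Rightarrow> bool" where
  "smooth_on S f \<longleftrightarrow> (\<forall>k. Ck_on k S f)"

type_synonym ('a, 'e) chart = "'a set \<times> ('a \<Rightarrow> 'e)"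

definition is_chart :: "'a topology \<Rightarrow> ('a, 'e::euclidean_space) chart \<Rightarrow> bool" where
  "is_chart T c \<longleftrightarrow> (case c of (U, x) \<Rightarrow> openin T U \<and> open (x ` U) \<and>
     homeomorphic_map (subtopology T U) (top_of_set (x ` U)) x)"

definition points :: "('a, 'e) chart set \<Rightarrow> 'a set" where
  "points A = (\<Union>(U, x)\<in>A. U)"

text \<open>The dimension of the manifold is \<open>DIM('e)\<close>.\<close>

definition smooth_manifold :: "'a topology \<Rightarrow> ('a, 'e::euclidean_space) chart set \<Rightarrow> bool" where
  "smooth_manifold T A \<longleftrightarrow> Hausdorff_space T \<and> second_countable T \<and>
     (\<forall>c\<in>A. is_chart T c) \<and> points A = topspace T \<and>
     (\<forall>(U, x)\<in>A. \<forall>(V, y)\<in>A. smooth_on (x ` (U \<inter> V)) (y \<circ> inv_into U x))"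

definition smooth_fun :: "('a, 'e::euclidean_space) chart set \<Rightarrow> ('a \<Rightarrow> real) \<Rightarrow> bool" where
  "smooth_fun A f \<longleftrightarrow> (\<forall>(U, x)\<in>A. smooth_on (x ` U) (f \<circ> inv_into U x))"


section \<open>Tangent vectors and tensor fields\<close>

text \<open>Tangent vectors at \<open>p\<close> are the derivations at \<open>p\<close> of the algebra of smooth functions.
  They are set to \<open>0\<close> on the remaining functions, so that equality of tangent vectors is equality
  in HOL. Functions, vector fields and tensors may take any value outside the manifold; all
  conditions below refer to its points only.\<close>

type_synonym 'a tangent = "('a \<Rightarrow> real) \<Rightarrow> real"

definition tangent_space :: "('a, 'e::euclidean_space) chart set \<Rightarrow> 'a \<Rightarrow> 'a tangent set" where
  "tangent_space A p = {v.
     (\<forall>f h. smooth_fun A f \<longrightarrow> smooth_fun A h \<longrightarrow> v (f + h) = v f + v h) \<and>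
     (\<forall>c f. smooth_fun A f \<longrightarrow> v (c *\<^sub>R f) = c * v f) \<and>
     (\<forall>f h. smooth_fun A f \<longrightarrow> smooth_fun A h \<longrightarrow> v (f * h) = f p * v h + h p * v f) \<and>
     (\<forall>f. \<not> smooth_fun A f \<longrightarrow> v f = 0)}"

definition vector_fields :: "('a, 'e::euclidean_space) chart set \<Rightarrow> ('a \<Rightarrow> 'a tangent) set" where
  "vector_fields A = {X. (\<forall>p\<in>points A. X p \<in> tangent_space A p) \<and>
     (\<forall>f. smooth_fun A f \<longrightarrow> smooth_fun A (\<lambda>p. X p f))}"

definition linear_on_subspace :: "'v::real_vector set \<Rightarrow> ('v \<Rightarrow> 'w::real_vector) \<Rightarrow> bool" where
  "linear_on_subspace V h \<longleftrightarrow> (\<forall>u\<in>V. \<forall>v\<in>V. h (u + v) = h u + h v) \<and>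
     (\<forall>c. \<forall>v\<in>V. h (c *\<^sub>R v) = c *\<^sub>R h v)"

definition one_form ::
    "('a, 'e::euclidean_space) chart set \<Rightarrow> ('a \<Rightarrow> 'a tangent \<Rightarrow> real) \<Rightarrow> bool" where
  "one_form A \<eta> \<longleftrightarrow> (\<forall>p\<in>points A. linear_on_subspace (tangent_space A p) (\<eta> p)) \<and>
     (\<forall>X\<in>vector_fields A. smooth_fun A (\<lambda>p. \<eta> p (X p)))"

definition tensor_1_1 ::
    "('a, 'e::euclidean_space) chart set \<Rightarrow> ('a \<Rightarrow> 'a tangent \<Rightarrow> 'a tangent) \<Rightarrow> bool" where
  "tensor_1_1 A \<phi> \<longleftrightarrow>
     (\<forall>p\<in>points A. linear_on_subspace (tangent_space A p) (\<phi> p) \<and>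
        \<phi> p ` tangent_space A p \<subseteq> tangent_space A p) \<and>
     (\<forall>X\<in>vector_fields A. (\<lambda>p. \<phi> p (X p)) \<in> vector_fields A)"

definition riemannian_metric ::
    "('a, 'e::euclidean_space) chart set \<Rightarrow> ('a \<Rightarrow> 'a tangent \<Rightarrow> 'a tangent \<Rightarrow> real) \<Rightarrow> bool" where
  "riemannian_metric A g \<longleftrightarrow>
     (\<forall>p\<in>points A.
        (\<forall>u\<in>tangent_space A p. linear_on_subspace (tangent_space A p) (g p u)) \<and>
        (\<forall>u\<in>tangent_space A p. \<forall>v\<in>tangent_space A p. g p u v = g p v u) \<and>
        (\<forall>u\<in>tangent_space A p. u \<noteq> 0 \<longrightarrow> g p u u > 0)) \<and>
     (\<forall>X\<in>vector_fields A. \<forall>Y\<in>vector_fields A. smooth_fun A (\<lambda>p. g p (X p) (Y p)))"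


section \<open>Connections\<close>

definition lie_bracket :: "('a \<Rightarrow> 'a tangent) \<Rightarrow> ('a \<Rightarrow> 'a tangent) \<Rightarrow> 'a \<Rightarrow> 'a tangent" where
  "lie_bracket X Y p = (\<lambda>f. X p (\<lambda>q. Y q f) - Y p (\<lambda>q. X q f))"

type_synonym 'a conn = "('a \<Rightarrow> 'a tangent) \<Rightarrow> ('a \<Rightarrow> 'a tangent) \<Rightarrow> 'a \<Rightarrow> 'a tangent"

definition linear_connection :: "('a, 'e::euclidean_space) chart set \<Rightarrow> 'a conn \<Rightarrow> bool" where
  "linear_connection A D \<longleftrightarrow>
     (\<forall>X\<in>vector_fields A. \<forall>Y\<in>vector_fields A. D X Y \<in> vector_fields A) \<and>
     (\<forall>X\<in>vector_fields A. \<forall>Y\<in>vector_fields A. \<forall>Z\<in>vector_fields A. \<forall>p\<in>points A.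
        D (X + Y) Z p = D X Z p + D Y Z p \<and> D X (Y + Z) p = D X Y p + D X Z p) \<and>
     (\<forall>X\<in>vector_fields A. \<forall>Y\<in>vector_fields A. \<forall>f. smooth_fun A f \<longrightarrow> (\<forall>p\<in>points A.
        D (\<lambda>q. f q *\<^sub>R X q) Y p = f p *\<^sub>R D X Y p \<and>
        D X (\<lambda>q. f q *\<^sub>R Y q) p = X p f *\<^sub>R Y p + f p *\<^sub>R D X Y p))"

definition levi_civita :: "('a, 'e::euclidean_space) chart set \<Rightarrow>
    ('a \<Rightarrow> 'a tangent \<Rightarrow> 'a tangent \<Rightarrow> real) \<Rightarrow> 'a conn \<Rightarrow> bool" where
  "levi_civita A g D \<longleftrightarrow> linear_connection A D \<and>
     (\<forall>X\<in>vector_fields A. \<forall>Y\<in>vector_fields A. \<forall>p\<in>points A.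
        D X Y p - D Y X p = lie_bracket X Y p) \<and>
     (\<forall>X\<in>vector_fields A. \<forall>Y\<in>vector_fields A. \<forall>Z\<in>vector_fields A. \<forall>p\<in>points A.
        X p (\<lambda>q. g q (Y q) (Z q)) = g p (D X Y p) (Z p) + g p (Y p) (D X Z p))"

text \<open>\<open>cov_deriv D \<phi> X Y\<close> is the vector field \<open>(D\<^sub>X \<phi>) Y\<close>.\<close>

definition cov_deriv :: "'a conn \<Rightarrow> ('a \<Rightarrow> 'a tangent \<Rightarrow> 'a tangent) \<Rightarrow> 'a conn" where
  "cov_deriv D \<phi> X Y = (\<lambda>p. D X (\<lambda>q. \<phi> q (Y q)) p - \<phi> p (D X Y p))"


section \<open>3-Sasakian manifolds\<close>

definition sasakian :: "('a, 'e::euclidean_space) chart set \<Rightarrow>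
    ('a \<Rightarrow> 'a tangent \<Rightarrow> 'a tangent \<Rightarrow> real) \<Rightarrow> 'a conn \<Rightarrow>
    ('a \<Rightarrow> 'a tangent \<Rightarrow> 'a tangent) \<Rightarrow> ('a \<Rightarrow> 'a tangent \<Rightarrow> real) \<Rightarrow> ('a \<Rightarrow> 'a tangent) \<Rightarrow> bool" where
  "sasakian A g nabla \<phi> \<eta> \<xi> \<longleftrightarrow>
     tensor_1_1 A \<phi> \<and> one_form A \<eta> \<and> \<xi> \<in> vector_fields A \<and>
     (\<forall>p\<in>points A. \<eta> p (\<xi> p) = 1 \<and>
        (\<forall>u\<in>tangent_space A p.
           \<phi> p (\<phi> p u) = - u + \<eta> p u *\<^sub>R \<xi> p \<and>
           \<eta> p u = g p (\<xi> p) u \<and>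
           (\<forall>v\<in>tangent_space A p. g p (\<phi> p u) (\<phi> p v) = g p u v - \<eta> p u * \<eta> p v))) \<and>
     (\<forall>X\<in>vector_fields A. \<forall>Y\<in>vector_fields A. \<forall>p\<in>points A.
        cov_deriv nabla \<phi> X Y p = g p (X p) (Y p) *\<^sub>R \<xi> p - \<eta> p (Y p) *\<^sub>R X p)"

text \<open>\<open>T\<close> and \<open>A\<close> are the topology and the atlas, \<open>nabla\<close> is the Levi-Civita connection of \<open>g\<close>;
  the structure tensors are indexed by \<open>1, 2, 3\<close>, and other indices are irrelevant.\<close>

definition three_sasakian :: "'a topology \<Rightarrow> ('a, 'e::euclidean_space) chart set \<Rightarrow>
    ('a \<Rightarrow> 'a tangent \<Rightarrow> 'a tangent \<Rightarrow> real) \<Rightarrow> 'a conn \<Rightarrow>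
    (nat \<Rightarrow> 'a \<Rightarrow> 'a tangent \<Rightarrow> 'a tangent) \<Rightarrow> (nat \<Rightarrow> 'a \<Rightarrow> 'a tangent \<Rightarrow> real) \<Rightarrow>
    (nat \<Rightarrow> 'a \<Rightarrow> 'a tangent) \<Rightarrow> bool" where
  "three_sasakian T A g nabla \<phi> \<eta> \<xi> \<longleftrightarrow>
     smooth_manifold T A \<and> (\<exists>n. DIM('e) = 4 * n + 3) \<and>
     riemannian_metric A g \<and> levi_civita A g nabla \<and>
     (\<forall>\<alpha>\<in>{1, 2, 3}. sasakian A g nabla (\<phi> \<alpha>) (\<eta> \<alpha>) (\<xi> \<alpha>)) \<and>
     (\<forall>(\<beta>, \<gamma>, \<theta>)\<in>{(1, 2, 3), (2, 3, 1), (3, 1, 2)}. \<forall>p\<in>points A.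
        \<xi> \<theta> p = \<phi> \<beta> p (\<xi> \<gamma> p) \<and> \<xi> \<theta> p = - \<phi> \<gamma> p (\<xi> \<beta> p) \<and>
        (\<forall>u\<in>tangent_space A p.
           \<phi> \<theta> p u = \<phi> \<beta> p (\<phi> \<gamma> p u) - \<eta> \<gamma> p u *\<^sub>R \<xi> \<beta> p \<and>
           \<phi> \<theta> p u = - \<phi> \<gamma> p (\<phi> \<beta> p u) + \<eta> \<beta> p u *\<^sub>R \<xi> \<gamma> p \<and>
           \<eta> \<theta> p u = \<eta> \<beta> p (\<phi> \<gamma> p u) \<and> \<eta> \<theta> p u = - \<eta> \<gamma> p (\<phi> \<beta> p u)))"

definition horizontal :: "('a, 'e::euclidean_space) chart set \<Rightarrow>
    (nat \<Rightarrow> 'a \<Rightarrow> 'a tangent \<Rightarrow> real) \<Rightarrow> 'a \<Rightarrow> 'a tangent set" where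
  "horizontal A \<eta> p = (\<Inter>\<alpha>\<in>{1, 2, 3}. {u \<in> tangent_space A p. \<eta> \<alpha> p u = 0})"

definition horizontal_sections :: "('a, 'e::euclidean_space) chart set \<Rightarrow>
    (nat \<Rightarrow> 'a \<Rightarrow> 'a tangent \<Rightarrow> real) \<Rightarrow> ('a \<Rightarrow> 'a tangent) set" where
  "horizontal_sections A \<eta> = {X \<in> vector_fields A. \<forall>p\<in>points A. X p \<in> horizontal A \<eta> p}"

definition fundamental_form :: "('a \<Rightarrow> 'a tangent \<Rightarrow> 'a tangent \<Rightarrow> real) \<Rightarrow>
    ('a \<Rightarrow> 'a tangent \<Rightarrow> 'a tangent) \<Rightarrow> 'a \<Rightarrow> 'a tangent \<Rightarrow> 'a tangent \<Rightarrow> real" where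
  "fundamental_form g \<phi> p u v = g p u (\<phi> p v)"

definition nabla_bar :: "('a \<Rightarrow> 'a tangent \<Rightarrow> 'a tangent \<Rightarrow> real) \<Rightarrow> 'a conn \<Rightarrow>
    (nat \<Rightarrow> 'a \<Rightarrow> 'a tangent \<Rightarrow> 'a tangent) \<Rightarrow> (nat \<Rightarrow> 'a \<Rightarrow> 'a tangent \<Rightarrow> real) \<Rightarrow>
    (nat \<Rightarrow> 'a \<Rightarrow> 'a tangent) \<Rightarrow> 'a conn" where
  "nabla_bar g nabla \<phi> \<eta> \<xi> X Y = (\<lambda>p. nabla X Y p
     - (\<Sum>\<alpha>\<in>{1, 2, 3}. \<eta> \<alpha> p (X p) *\<^sub>R nabla Y (\<xi> \<alpha>) p)
     - (\<Sum>\<alpha>\<in>{1, 2, 3}. \<eta> \<alpha> p (Y p) *\<^sub>R nabla X (\<xi> \<alpha>) p)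
     + (\<Sum>\<alpha>\<in>{1, 2, 3}. fundamental_form g (\<phi> \<alpha>) p (X p) (Y p) *\<^sub>R \<xi> \<alpha> p))"

end

theory Submission
  imports Defs
begin

text \<open>On horizontal sections every term in the difference of the two connections that carries a
  factor \<open>\<eta>\<^sup>\<alpha>\<close> drops out, so the modified connection is \<open>\<nabla>\<close> plus the vertical term
  \<open>\<Sum>\<^sub>\<beta> \<Omega>\<^sup>\<beta>(X, Y) \<xi>\<^sub>\<beta>\<close>. Since \<open>\<phi>\<^sub>\<alpha>\<close> maps the horizontal distribution to itself, this also holds
  with \<open>\<phi>\<^sub>\<alpha> Y\<close> in place of \<open>Y\<close>, and the Sasakian condition reduces \<open>(\<nabla>\<^sub>X \<phi>\<^sub>\<alpha>) Y\<close> to \<open>g(X, Y) \<xi>\<^sub>\<alpha>\<close>.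
  What remains is to see that the commutator of the vertical term with \<open>\<phi>\<^sub>\<alpha>\<close> is \<open>- g(X, Y) \<xi>\<^sub>\<alpha>\<close>.

  That is quaternion algebra at one point. For a cyclic triple \<open>(\<alpha>, \<beta>, \<gamma>)\<close> the \<open>\<phi>\<close>'s satisfy
  the quaternion relations on horizontal vectors, while \<open>\<phi>\<^sub>\<alpha>\<close> rotates the vertical frame:
  \<open>\<xi>\<^sub>\<alpha> \<mapsto> 0\<close>, \<open>\<xi>\<^sub>\<beta> \<mapsto> \<xi>\<^sub>\<gamma>\<close>, \<open>\<xi>\<^sub>\<gamma> \<mapsto> - \<xi>\<^sub>\<beta>\<close>. The \<open>\<xi>\<^sub>\<beta>\<close> and \<open>\<xi>\<^sub>\<gamma>\<close> components of the commutator cancel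
  against each other, and its \<open>\<xi>\<^sub>\<alpha>\<close> component is \<open>g(X, \<phi>\<^sub>\<alpha>\<^sup>2 Y) = - g(X, Y)\<close>. The two pointwise
  computations are the lemmas \<open>phi_preserves_horizontal\<close> and \<open>vertical_correction_commutator\<close>.\<close>

lemma linear_on_subspace_add:
  "linear_on_subspace V h \<Longrightarrow> u \<in> V \<Longrightarrow> v \<in> V \<Longrightarrow> h (u + v) = h u + h v"
  by (simp add: linear_on_subspace_def)

lemma linear_on_subspace_scaleR:
  "linear_on_subspace V h \<Longrightarrow> v \<in> V \<Longrightarrow> h (c *\<^sub>R v) = c *\<^sub>R h v"
  by (simp add: linear_on_subspace_def)

lemma linear_on_subspace_minus:
  "linear_on_subspace V h \<Longrightarrow> v \<in> V \<Longrightarrow> h (- v) = - h v"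
  using linear_on_subspace_scaleR[of V h v "-1"] by simp

lemma linear_on_subspace_diff:
  assumes "subspace V" "linear_on_subspace V h" "u \<in> V" "v \<in> V"
  shows "h (u - v) = h u - h v"
  using linear_on_subspace_add[of V h u "- v"] linear_on_subspace_minus[of V h v]
    subspace_neg[of V v] assms by simp

lemma linear_on_subspace_zero:
  "linear_on_subspace V h \<Longrightarrow> v \<in> V \<Longrightarrow> h 0 = 0"
  using linear_on_subspace_scaleR[of V h v 0] by simp

lemma subspace_tangent_space: "subspace (tangent_space A p)"
  by (rule subspaceI)
    (auto simp: tangent_space_def scaleR_fun_def plus_fun_def zero_fun_def algebra_simps)

text \<open>The squared norm of \<open>\<phi> \<xi>\<close> is \<open>\<eta>(\<xi>) - \<eta>(\<xi>)\<^sup>2 = 0\<close> by compatibility of \<open>g\<close> with \<open>\<phi>\<close>.\<close>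

lemma sasakian_phi_xi:
  assumes g: "riemannian_metric A g" and s: "sasakian A g nabla \<phi> \<eta> \<xi>" and p: "p \<in> points A"
  shows "\<phi> p (\<xi> p) = 0"
proof -
  have xi: "\<xi> p \<in> tangent_space A p"
    using s p by (auto simp: sasakian_def vector_fields_def)
  then have "\<phi> p (\<xi> p) \<in> tangent_space A p"
    using s p by (auto simp: sasakian_def tensor_1_1_def)
  moreover have "g p (\<phi> p (\<xi> p)) (\<phi> p (\<xi> p)) = g p (\<xi> p) (\<xi> p) - \<eta> p (\<xi> p) * \<eta> p (\<xi> p)"
    using s p xi unfolding sasakian_def by blast
  moreover have "g p (\<xi> p) (\<xi> p) = \<eta> p (\<xi> p)" "\<eta> p (\<xi> p) = 1"
    using s p xi unfolding sasakian_def by metis+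
  ultimately show ?thesis
    using g p unfolding riemannian_metric_def by fastforce
qed

text \<open>Computing \<open>\<phi>\<^sup>3 u\<close> as \<open>\<phi>\<^sup>2 (\<phi> u)\<close> and as \<open>\<phi> (\<phi>\<^sup>2 u)\<close> gives results that differ by
  \<open>\<eta>(\<phi> u) \<xi>\<close>, because \<open>\<phi> \<xi> = 0\<close>.\<close>

lemma sasakian_eta_phi:
  assumes g: "riemannian_metric A g" and s: "sasakian A g nabla \<phi> \<eta> \<xi>" and p: "p \<in> points A"
    and u: "u \<in> tangent_space A p"
  shows "\<eta> p (\<phi> p u) = 0"
proof -
  let ?V = "tangent_space A p"
  have xi: "\<xi> p \<in> ?V"
    using s p by (auto simp: sasakian_def vector_fields_def)
  have lin: "linear_on_subspace ?V (\<phi> p)" and phi: "\<phi> p u \<in> ?V"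
    using s p u by (auto simp: sasakian_def tensor_1_1_def)
  have eta: "linear_on_subspace ?V (\<eta> p)" and one: "\<eta> p (\<xi> p) = 1"
    using s p by (auto simp: sasakian_def one_form_def)
  have sq: "\<phi> p (\<phi> p v) = - v + \<eta> p v *\<^sub>R \<xi> p" if "v \<in> ?V" for v
    using s p that unfolding sasakian_def by blast
  have "- \<phi> p u + \<eta> p (\<phi> p u) *\<^sub>R \<xi> p = \<phi> p (- u + \<eta> p u *\<^sub>R \<xi> p)"
    using sq[OF phi] sq[OF u] by simp
  also have "\<dots> = - \<phi> p u"
    using u xi sasakian_phi_xi[OF g s p]
    by (simp add: linear_on_subspace_diff[OF subspace_tangent_space lin]
        linear_on_subspace_scaleR[OF lin] subspace_scale[OF subspace_tangent_space])
  finally have "\<eta> p (\<phi> p u) *\<^sub>R \<xi> p = 0"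
    by simp
  then have "\<eta> p (\<phi> p u) * \<eta> p (\<xi> p) = \<eta> p 0"
    using linear_on_subspace_scaleR[OF eta xi, of "\<eta> p (\<phi> p u)"] by (metis real_scaleR_def)
  then show ?thesis
    using one linear_on_subspace_zero[OF eta xi] by simp
qed

definition cyclic_triple :: "nat \<Rightarrow> nat \<Rightarrow> nat \<Rightarrow> bool" where
  "cyclic_triple a b c \<longleftrightarrow> (a, b, c) \<in> {(1, 2, 3), (2, 3, 1), (3, 1, 2)}"

lemma cyclic_triple_indices: "cyclic_triple a b c \<Longrightarrow> {a, b, c} = {1, 2, 3}"
  by (auto simp: cyclic_triple_def)

lemma cyclic_triple_sum:
  "cyclic_triple a b c \<Longrightarrow> sum f {1, 2, 3} = f a + (f b + f c)"
  for f :: "nat \<Rightarrow> 'v::ab_group_add"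
  by (auto simp: cyclic_triple_def algebra_simps)

lemma cyclic_triple_rotate: "cyclic_triple a b c \<Longrightarrow> cyclic_triple b c a"
  by (auto simp: cyclic_triple_def)

lemma cyclic_triple_exists:
  assumes "a \<in> {1, 2, 3}"
  obtains b c where "cyclic_triple a b c"
  using assms by (auto simp: cyclic_triple_def)

lemma three_sasakian_components:
  assumes "three_sasakian T A g nabla \<phi> \<eta> \<xi>"
  shows "riemannian_metric A g" and "levi_civita A g nabla"
    and "a \<in> {1, 2, 3} \<Longrightarrow> sasakian A g nabla (\<phi> a) (\<eta> a) (\<xi> a)"
proof -
  have "riemannian_metric A g \<and> levi_civita A g nabla \<and>
      (\<forall>\<alpha>\<in>{1, 2, 3}. sasakian A g nabla (\<phi> \<alpha>) (\<eta> \<alpha>) (\<xi> \<alpha>))"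
    using assms unfolding three_sasakian_def by (elim conjE) (intro conjI)
  then show "riemannian_metric A g" and "levi_civita A g nabla"
    and "a \<in> {1, 2, 3} \<Longrightarrow> sasakian A g nabla (\<phi> a) (\<eta> a) (\<xi> a)"
    by blast+
qed

lemma three_sasakian_cyclic:
  assumes "three_sasakian T A g nabla \<phi> \<eta> \<xi>" and "cyclic_triple a b c" and "p \<in> points A"
  shows "\<xi> c p = \<phi> a p (\<xi> b p)" and "\<xi> c p = - \<phi> b p (\<xi> a p)"
    and "u \<in> tangent_space A p \<Longrightarrow> \<phi> c p u = \<phi> a p (\<phi> b p u) - \<eta> b p u *\<^sub>R \<xi> a p"
    and "u \<in> tangent_space A p \<Longrightarrow> \<phi> c p u = - \<phi> b p (\<phi> a p u) + \<eta> a p u *\<^sub>R \<xi> b p"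
    and "u \<in> tangent_space A p \<Longrightarrow> \<eta> c p u = \<eta> a p (\<phi> b p u)"
    and "u \<in> tangent_space A p \<Longrightarrow> \<eta> c p u = - \<eta> b p (\<phi> a p u)"
proof -
  have "\<xi> c p = \<phi> a p (\<xi> b p) \<and> \<xi> c p = - \<phi> b p (\<xi> a p) \<and>
        (\<forall>u\<in>tangent_space A p.
           \<phi> c p u = \<phi> a p (\<phi> b p u) - \<eta> b p u *\<^sub>R \<xi> a p \<and>
           \<phi> c p u = - \<phi> b p (\<phi> a p u) + \<eta> a p u *\<^sub>R \<xi> b p \<and>
           \<eta> c p u = \<eta> a p (\<phi> b p u) \<and> \<eta> c p u = - \<eta> b p (\<phi> a p u))"
    using assms unfolding three_sasakian_def cyclic_triple_def by blast
  then show "\<xi> c p = \<phi> a p (\<xi> b p)" and "\<xi> c p = - \<phi> b p (\<xi> a p)"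
    and "u \<in> tangent_space A p \<Longrightarrow> \<phi> c p u = \<phi> a p (\<phi> b p u) - \<eta> b p u *\<^sub>R \<xi> a p"
    and "u \<in> tangent_space A p \<Longrightarrow> \<phi> c p u = - \<phi> b p (\<phi> a p u) + \<eta> a p u *\<^sub>R \<xi> b p"
    and "u \<in> tangent_space A p \<Longrightarrow> \<eta> c p u = \<eta> a p (\<phi> b p u)"
    and "u \<in> tangent_space A p \<Longrightarrow> \<eta> c p u = - \<eta> b p (\<phi> a p u)"
    by blast+
qed

lemma horizontal_cyclic:
  assumes "cyclic_triple a b c"
  shows "u \<in> horizontal A \<eta> p \<longleftrightarrow>
    u \<in> tangent_space A p \<and> \<eta> a p u = 0 \<and> \<eta> b p u = 0 \<and> \<eta> c p u = 0"
  unfolding horizontal_def cyclic_triple_indices[OF assms, symmetric] by auto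

text \<open>On the tangent space \<open>\<eta>\<^sup>\<alpha> \<circ> \<phi>\<^sub>\<alpha>\<close> vanishes, while for \<open>\<beta> \<noteq> \<alpha>\<close> the form \<open>\<eta>\<^sup>\<beta> \<circ> \<phi>\<^sub>\<alpha>\<close> is up to sign
  the third of the forms \<open>\<eta>\<close>, which vanishes on horizontal vectors.\<close>

lemma phi_preserves_horizontal:
  assumes ts: "three_sasakian T A g nabla \<phi> \<eta> \<xi>" and a: "a \<in> {1, 2, 3}"
    and p: "p \<in> points A" and u: "u \<in> horizontal A \<eta> p"
  shows "\<phi> a p u \<in> horizontal A \<eta> p"
proof -
  obtain b c where abc: "cyclic_triple a b c"
    using cyclic_triple_exists[OF a] .
  have cab: "cyclic_triple c a b"
    using cyclic_triple_rotate[OF cyclic_triple_rotate[OF abc]] .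
  have g: "riemannian_metric A g" and s: "sasakian A g nabla (\<phi> a) (\<eta> a) (\<xi> a)"
    using three_sasakian_components[OF ts] a by blast+
  have ut: "u \<in> tangent_space A p" and "\<eta> b p u = 0" "\<eta> c p u = 0"
    using iffD1[OF horizontal_cyclic[OF abc] u] by simp_all
  moreover have "\<phi> a p u \<in> tangent_space A p"
    using s p ut by (auto simp: sasakian_def tensor_1_1_def)
  moreover have "\<eta> a p (\<phi> a p u) = 0"
    using sasakian_eta_phi[OF g s p ut] .
  ultimately show ?thesis
    using three_sasakian_cyclic(6)[OF ts abc p ut] three_sasakian_cyclic(5)[OF ts cab p ut]
    by (simp add: horizontal_cyclic[OF abc])
qed

lemma nabla_bar_horizontal:
  assumes "X p \<in> horizontal A \<eta> p" and "Y p \<in> horizontal A \<eta> p"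
  shows "nabla_bar g nabla \<phi> \<eta> \<xi> X Y p =
    nabla X Y p + (\<Sum>\<beta>\<in>{1, 2, 3}. g p (X p) (\<phi> \<beta> p (Y p)) *\<^sub>R \<xi> \<beta> p)"
  using assms by (simp add: nabla_bar_def horizontal_def fundamental_form_def)

text \<open>The vertical term that the modified connection adds contributes exactly the opposite of the
  defect \<open>(\<nabla>\<^sub>X \<phi>\<^sub>\<alpha>) Y = g(X, Y) \<xi>\<^sub>\<alpha>\<close> of the Levi-Civita connection.\<close>

lemma vertical_correction_commutator:
  assumes ts: "three_sasakian T A g nabla \<phi> \<eta> \<xi>" and a: "a \<in> {1, 2, 3}"
    and p: "p \<in> points A" and u: "u \<in> tangent_space A p" and v: "v \<in> horizontal A \<eta> p"
  shows "(\<Sum>\<beta>\<in>{1, 2, 3}. g p u (\<phi> \<beta> p (\<phi> a p v)) *\<^sub>R \<xi> \<beta> p) -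
      \<phi> a p (\<Sum>\<beta>\<in>{1, 2, 3}. g p u (\<phi> \<beta> p v) *\<^sub>R \<xi> \<beta> p) = - g p u v *\<^sub>R \<xi> a p"
proof -
  let ?V = "tangent_space A p"
  obtain b c where abc: "cyclic_triple a b c"
    using cyclic_triple_exists[OF a] .
  have cab: "cyclic_triple c a b"
    using cyclic_triple_rotate[OF cyclic_triple_rotate[OF abc]] .
  have bc: "b \<in> {1, 2, 3}" "c \<in> {1, 2, 3}"
    using cyclic_triple_indices[OF abc] by blast+
  have g: "riemannian_metric A g"
    and s: "\<And>\<beta>. \<beta> \<in> {1, 2, 3} \<Longrightarrow> sasakian A g nabla (\<phi> \<beta>) (\<eta> \<beta>) (\<xi> \<beta>)"
    using three_sasakian_components[OF ts] by blast+
  have vt: "v \<in> ?V" and v0: "\<eta> a p v = 0" "\<eta> b p v = 0" "\<eta> c p v = 0"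
    using iffD1[OF horizontal_cyclic[OF abc] v] by simp_all
  have xi: "\<xi> \<beta> p \<in> ?V" and phi: "\<phi> \<beta> p v \<in> ?V" and lin: "linear_on_subspace ?V (\<phi> \<beta> p)"
    if "\<beta> \<in> {1, 2, 3}" for \<beta>
    using s[OF that] p vt by (auto simp: sasakian_def vector_fields_def tensor_1_1_def)
  have g_lin: "linear_on_subspace ?V (g p u)"
    using g p u by (simp add: riemannian_metric_def)
  have quat_a: "\<phi> a p (\<phi> a p v) = - v"
    using s[OF a] p vt v0 by (simp add: sasakian_def)
  have quat_b: "\<phi> b p (\<phi> a p v) = - \<phi> c p v"
    using three_sasakian_cyclic(4)[OF ts abc p vt] v0 by simp
  have quat_c: "\<phi> c p (\<phi> a p v) = \<phi> b p v"
    using three_sasakian_cyclic(3)[OF ts cab p vt] v0 by simp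
  have rot_a: "\<phi> a p (\<xi> a p) = 0"
    using sasakian_phi_xi[OF g s[OF a] p] .
  have rot_b: "\<phi> a p (\<xi> b p) = \<xi> c p"
    using three_sasakian_cyclic(1)[OF ts abc p] by simp
  have rot_c: "\<phi> a p (\<xi> c p) = - \<xi> b p"
    using three_sasakian_cyclic(2)[OF ts cab p] by simp
  have "(\<Sum>\<beta>\<in>{1, 2, 3}. g p u (\<phi> \<beta> p (\<phi> a p v)) *\<^sub>R \<xi> \<beta> p) =
      - g p u v *\<^sub>R \<xi> a p + (- g p u (\<phi> c p v) *\<^sub>R \<xi> b p + g p u (\<phi> b p v) *\<^sub>R \<xi> c p)"
    unfolding cyclic_triple_sum[OF abc] quat_a quat_b quat_c
    using linear_on_subspace_minus[OF g_lin vt] linear_on_subspace_minus[OF g_lin phi[OF bc(2)]]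
    by simp
  moreover have "\<phi> a p (\<Sum>\<beta>\<in>{1, 2, 3}. g p u (\<phi> \<beta> p v) *\<^sub>R \<xi> \<beta> p) =
      g p u (\<phi> b p v) *\<^sub>R \<xi> c p - g p u (\<phi> c p v) *\<^sub>R \<xi> b p"
    unfolding cyclic_triple_sum[OF abc]
    using xi[OF a] xi[OF bc(1)] xi[OF bc(2)]
    by (simp add: linear_on_subspace_add[OF lin[OF a]] linear_on_subspace_scaleR[OF lin[OF a]]
        subspace_add[OF subspace_tangent_space] subspace_scale[OF subspace_tangent_space]
        rot_a rot_b rot_c)
  ultimately show ?thesis
    by simp
qed

theorem theorem4:
  fixes T :: "'a topology" and A :: "('a, 'e::euclidean_space) chart set"
    and g :: "'a \<Rightarrow> 'a tangent \<Rightarrow> 'a tangent \<Rightarrow> real"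
    and nabla :: "'a conn"
    and \<phi> :: "nat \<Rightarrow> 'a \<Rightarrow> 'a tangent \<Rightarrow> 'a tangent"
    and \<eta> :: "nat \<Rightarrow> 'a \<Rightarrow> 'a tangent \<Rightarrow> real"
    and \<xi> :: "nat \<Rightarrow> 'a \<Rightarrow> 'a tangent"
  assumes "three_sasakian T A g nabla \<phi> \<eta> \<xi>"
  shows "\<forall>\<alpha>\<in>{1, 2, 3}. \<forall>X\<in>horizontal_sections A \<eta>. \<forall>Y\<in>horizontal_sections A \<eta>. \<forall>p\<in>points A.
           cov_deriv (nabla_bar g nabla \<phi> \<eta> \<xi>) (\<phi> \<alpha>) X Y p = 0"
proof (intro ballI)
  fix \<alpha> :: nat and X Y p
  assume \<alpha>: "\<alpha> \<in> {1, 2, 3}" and X: "X \<in> horizontal_sections A \<eta>"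
    and Y: "Y \<in> horizontal_sections A \<eta>" and p: "p \<in> points A"
  let ?V = "tangent_space A p"
  let ?S = "\<lambda>v. \<Sum>\<beta>\<in>{1, 2, 3}. g p (X p) (\<phi> \<beta> p v) *\<^sub>R \<xi> \<beta> p"
  have Xv: "X \<in> vector_fields A" and Yv: "Y \<in> vector_fields A"
    and Xh: "X p \<in> horizontal A \<eta> p" and Yh: "Y p \<in> horizontal A \<eta> p"
    using X Y p by (auto simp: horizontal_sections_def)
  have Xt: "X p \<in> ?V" and Y0: "\<eta> \<alpha> p (Y p) = 0"
    using Xh Yh \<alpha> by (auto simp: horizontal_def)
  have s: "\<And>\<beta>. \<beta> \<in> {1, 2, 3} \<Longrightarrow> sasakian A g nabla (\<phi> \<beta>) (\<eta> \<beta>) (\<xi> \<beta>)"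
    and lc: "levi_civita A g nabla"
    using three_sasakian_components[OF assms] by blast+
  have lin: "linear_on_subspace ?V (\<phi> \<alpha> p)"
    using s[OF \<alpha>] p by (simp add: sasakian_def tensor_1_1_def)
  have nabla_in: "nabla X Y p \<in> ?V"
    using lc Xv Yv p by (auto simp: levi_civita_def linear_connection_def vector_fields_def)
  have "\<xi> \<beta> p \<in> ?V" if "\<beta> \<in> {1, 2, 3}" for \<beta>
    using s[OF that] p by (auto simp: sasakian_def vector_fields_def)
  then have S_in: "?S (Y p) \<in> ?V"
    by (intro subspace_sum subspace_scale subspace_tangent_space)
  have "cov_deriv (nabla_bar g nabla \<phi> \<eta> \<xi>) (\<phi> \<alpha>) X Y p =
      nabla X (\<lambda>q. \<phi> \<alpha> q (Y q)) p + ?S (\<phi> \<alpha> p (Y p)) - \<phi> \<alpha> p (nabla X Y p + ?S (Y p))"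
    using nabla_bar_horizontal[where X = X and Y = "\<lambda>q. \<phi> \<alpha> q (Y q)" and p = p, OF Xh
        phi_preserves_horizontal[OF assms \<alpha> p Yh]]
      nabla_bar_horizontal[where X = X and Y = Y and p = p, OF Xh Yh]
    by (simp only: cov_deriv_def)
  also have "\<dots> = cov_deriv nabla (\<phi> \<alpha>) X Y p + (?S (\<phi> \<alpha> p (Y p)) - \<phi> \<alpha> p (?S (Y p)))"
    unfolding cov_deriv_def linear_on_subspace_add[OF lin nabla_in S_in]
    by (simp add: algebra_simps)
  also have "cov_deriv nabla (\<phi> \<alpha>) X Y p = g p (X p) (Y p) *\<^sub>R \<xi> \<alpha> p"
    using s[OF \<alpha>] Xv Yv p Y0 by (simp add: sasakian_def)
  also have "?S (\<phi> \<alpha> p (Y p)) - \<phi> \<alpha> p (?S (Y p)) = - g p (X p) (Y p) *\<^sub>R \<xi> \<alpha> p"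
    using vertical_correction_commutator[OF assms \<alpha> p Xt Yh] .
  finally show "cov_deriv (nabla_bar g nabla \<phi> \<eta> \<xi>) (\<phi> \<alpha>) X Y p = 0"
    by (simp only: scaleR_minus_left add.right_inverse)
qed

end
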